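(* If $w_{\alpha}$ is the characteristic Sturmian word with irrational slope $0 <\alpha < \frac{1}{4}$, then for all $\ell>0$ $$\rho_{w_{\alpha}, \ell}^{(S_2, S_{\ell})} = \begin{cases} 1 & \text{if } \ell=1\\ 2 & \text{if } \ell>1,\end{cases}$$ where $S_2$ acts by permuting (exchanging) the letters of the alphabet $\{0,1\}$ and $S_\ell$ acts by permuting the $\ell$ positions.
   Context: For irrational $0<\alpha<1$, the characteristic Sturmian word of slope $\alpha$ is the infinite binary word $w_\alpha \in \{0,1\}^\omega$ given by $w_\alpha[n] = \lfloor (n+2)\alpha\rfloor - \lfloor (n+1)\alpha \rfloor$ for $n \ge 0$. A factor of an infinite word is a finite contiguous subsequence. Let $G$ be a group acting on an alphabet $\Sigma$, hence letterwise on words, and let $H_\ell$ be a group acting on $\Sigma^\ell$ by permuting positions; then $G \times H_\ell$ acts on $\Sigma^\ell$ by $(g,h)\cdot w = g\cdot(h\cdot w) = h\cdot(g\cdot w)$. For an infinite word $w$ over $\Sigma$, $\rho_{w,\ell}^{(G,H_\ell)}$ denotes the number of equivalence classes in the set of length-$\ell$ factors of $w$, where two factors are equivalent if they lie in the same $G\times H_\ell$-orbit in $\Sigma^\ell$. *)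

theory Defs
  imports Complex_Main "HOL-Algebra.Group_Action" "HOL-Library.Omega_Words_Fun"
begin

definition sturmian :: "real \<Rightarrow> int word" where
  "sturmian \<alpha> n = \<lfloor>(real n + 2) * \<alpha>\<rfloor> - \<lfloor>(real n + 1) * \<alpha>\<rfloor>"

definition factors :: "'a word \<Rightarrow> nat \<Rightarrow> 'a list set" where
  "factors w l = {w [i \<rightarrow> i + l] | i. True}"

definition words :: "'a set \<Rightarrow> nat \<Rightarrow> 'a list set" where
  "words S l = {u. length u = l \<and> set u \<subseteq> S}"

text \<open>
  A group \<open>H\<close> acting on the positions \<open>{..<l}\<close> through \<open>\<psi>\<close> acts on words by moving the letter at
  position \<open>i\<close> to position \<open>\<psi> h i\<close>. The letter at position \<open>i\<close> of the result is thus the one that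
  was at position \<open>\<psi> (inv h) i\<close>; the inverse makes this a left action.
\<close>

definition permute_positions ::
  "('h, 'm) monoid_scheme \<Rightarrow> ('h \<Rightarrow> nat \<Rightarrow> nat) \<Rightarrow> 'h \<Rightarrow> 'a list \<Rightarrow> 'a list" where
  "permute_positions H \<psi> h u = map (\<lambda>i. u ! \<psi> (inv\<^bsub>H\<^esub> h) i) [0..<length u]"

text \<open>
  The action of \<open>G \<times>\<times> H\<close> on \<open>words S l\<close>, where \<open>G\<close> acts on the alphabet \<open>S\<close> through \<open>\<phi>\<close>. It is
  restricted to \<open>words S l\<close> because \<^locale>\<open>group_action\<close> requires extensional maps.
\<close>

definition word_action ::
  "('g \<Rightarrow> 'a \<Rightarrow> 'a) \<Rightarrow> ('h, 'm) monoid_scheme \<Rightarrow> ('h \<Rightarrow> nat \<Rightarrow> nat) \<Rightarrow> 'a set \<Rightarrow> nat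
    \<Rightarrow> 'g \<times> 'h \<Rightarrow> 'a list \<Rightarrow> 'a list" where
  "word_action \<phi> H \<psi> S l = (\<lambda>(g, h). \<lambda>u \<in> words S l. map (\<phi> g) (permute_positions H \<psi> h u))"

definition factor_equiv ::
  "('g, 'n) monoid_scheme \<Rightarrow> ('g \<Rightarrow> 'a \<Rightarrow> 'a) \<Rightarrow> ('h, 'm) monoid_scheme \<Rightarrow> ('h \<Rightarrow> nat \<Rightarrow> nat)
    \<Rightarrow> 'a set \<Rightarrow> 'a word \<Rightarrow> nat \<Rightarrow> 'a list rel" where
  "factor_equiv G \<phi> H \<psi> S w l =
     {(u, v). u \<in> factors w l \<and> v \<in> factors w l \<and>
              v \<in> orbit (G \<times>\<times> H) (word_action \<phi> H \<psi> S l) u}"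

definition group_complexity ::
  "('g, 'n) monoid_scheme \<Rightarrow> ('g \<Rightarrow> 'a \<Rightarrow> 'a) \<Rightarrow> ('h, 'm) monoid_scheme \<Rightarrow> ('h \<Rightarrow> nat \<Rightarrow> nat)
    \<Rightarrow> 'a set \<Rightarrow> 'a word \<Rightarrow> nat \<Rightarrow> nat" where
  "group_complexity G \<phi> H \<psi> S w l = card (factors w l // factor_equiv G \<phi> H \<psi> S w l)"

text \<open>The symmetric group on \<open>S\<close> is \<^term>\<open>BijGroup S\<close>; it acts on \<open>S\<close> by evaluation.\<close>

lemma group_action_BijGroup: "group_action (BijGroup S) S (\<lambda>f. f)"
  unfolding group_action_def group_hom_def group_hom_axioms_def
  by (auto simp: group_BijGroup hom_def group.is_monoid monoid.m_closed)

lemma permute_positions_in_words: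
  assumes "group_action H {..<l} \<psi>" "h \<in> carrier H" "u \<in> words S l"
  shows "permute_positions H \<psi> h u \<in> words S l"
proof -
  interpret H: group_action H "{..<l}" \<psi> by fact
  interpret H: group H using H.group_hom group_hom.axioms(1) by auto
  have "\<psi> (inv\<^bsub>H\<^esub> h) i < l" if "i < l" for i
    using H.element_image[of "inv\<^bsub>H\<^esub> h" i] that assms(2) by auto
  then show ?thesis
    using assms(3) by (auto simp: words_def permute_positions_def)
qed

lemma map_in_words:
  assumes "group_action G S \<phi>" "g \<in> carrier G" "u \<in> words S l"
  shows "map (\<phi> g) u \<in> words S l"
  using assms group_action.element_image[OF assms(1,2)] by (auto simp: words_def)

lemma map_permute_positions:
  assumes "group_action H {..<l} \<psi>" "h \<in> carrier H" "length u = l"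
  shows "map f (permute_positions H \<psi> h u) = permute_positions H \<psi> h (map f u)"
proof -
  interpret H: group_action H "{..<l}" \<psi> by fact
  interpret H: group H using H.group_hom group_hom.axioms(1) by auto
  have "\<psi> (inv\<^bsub>H\<^esub> h) i < l" if "i < l" for i
    using H.element_image[of "inv\<^bsub>H\<^esub> h" i] that assms(2) by auto
  then show ?thesis using assms(3) by (auto simp: permute_positions_def)
qed

lemma permute_positions_mult:
  assumes "group_action H {..<l} \<psi>" "h \<in> carrier H" "k \<in> carrier H" "length u = l"
  shows "permute_positions H \<psi> (h \<otimes>\<^bsub>H\<^esub> k) u = permute_positions H \<psi> h (permute_positions H \<psi> k u)"
proof -
  interpret H: group_action H "{..<l}" \<psi> by fact
  interpret H: group H using H.group_hom group_hom.axioms(1) by auto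
  have "\<psi> (inv\<^bsub>H\<^esub> h) i < l" if "i < l" for i
    using H.element_image[of "inv\<^bsub>H\<^esub> h" i] that assms(2) by auto
  moreover have "\<psi> (inv\<^bsub>H\<^esub> (h \<otimes>\<^bsub>H\<^esub> k)) i = \<psi> (inv\<^bsub>H\<^esub> k) (\<psi> (inv\<^bsub>H\<^esub> h) i)" if "i < l" for i
    using H.composition_rule[of i "inv\<^bsub>H\<^esub> k" "inv\<^bsub>H\<^esub> h"] that assms(2,3)
    by (simp add: H.inv_mult_group)
  ultimately show ?thesis using assms(4) by (simp add: permute_positions_def)
qed

lemma permute_positions_one:
  assumes "group_action H {..<l} \<psi>" "length u = l"
  shows "permute_positions H \<psi> \<one>\<^bsub>H\<^esub> u = u"
proof -
  interpret H: group_action H "{..<l}" \<psi> by fact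
  interpret H: group H using H.group_hom group_hom.axioms(1) by auto
  have "\<psi> \<one>\<^bsub>H\<^esub> i = i" if "i < l" for i
    using H.id_eq_one[symmetric] that by simp
  then show ?thesis using assms(2) by (auto simp: permute_positions_def intro: nth_equalityI)
qed

lemma group_action_word_action:
  assumes G: "group_action G S \<phi>" and H: "group_action H {..<l} \<psi>"
  shows "group_action (G \<times>\<times> H) (words S l) (word_action \<phi> H \<psi> S l)"
proof -
  interpret G: group_action G S \<phi> by fact
  interpret H: group_action H "{..<l}" \<psi> by fact
  interpret G: group G using G.group_hom group_hom.axioms(1) by auto
  interpret H: group H using H.group_hom group_hom.axioms(1) by auto
  interpret P: group "G \<times>\<times> H" by (rule DirProd_group) unfold_locales
  let ?A = "word_action \<phi> H \<psi> S l" and ?W = "words S l"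
  have len: "length u = l" if "u \<in> ?W" for u using that by (simp add: words_def)
  have closed: "?A x u \<in> ?W" if "x \<in> carrier (G \<times>\<times> H)" "u \<in> ?W" for x u
    using that by (auto simp: word_action_def intro!: map_in_words[OF G] permute_positions_in_words[OF H])
  have mult: "?A (x \<otimes>\<^bsub>G \<times>\<times> H\<^esub> y) u = ?A x (?A y u)"
    if x: "x \<in> carrier (G \<times>\<times> H)" and y: "y \<in> carrier (G \<times>\<times> H)" and u: "u \<in> ?W" for x y u
  proof -
    obtain g h g' h' where xy: "x = (g, h)" "y = (g', h')" by (cases x, cases y)
    let ?v = "permute_positions H \<psi> h (permute_positions H \<psi> h' u)"
    have mem: "g \<in> carrier G" "h \<in> carrier H" "g' \<in> carrier G" "h' \<in> carrier H"
      using x y xy by auto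
    have p: "permute_positions H \<psi> h' u \<in> ?W"
      using permute_positions_in_words[OF H mem(4) u] .
    have v: "?v \<in> ?W" using permute_positions_in_words[OF H mem(2) p] .
    have m: "map (\<phi> g') (permute_positions H \<psi> h' u) \<in> ?W" using map_in_words[OF G mem(3) p] .
    have "?A (x \<otimes>\<^bsub>G \<times>\<times> H\<^esub> y) u = map (\<phi> (g \<otimes>\<^bsub>G\<^esub> g')) ?v"
      using u by (simp add: xy word_action_def permute_positions_mult[OF H mem(2,4) len[OF u]])
    also have "\<dots> = map (\<phi> g) (map (\<phi> g') ?v)"
      using v G.composition_rule[OF _ mem(1,3)] by (auto simp: words_def)
    also have "\<dots> = ?A x (?A y u)"
      using u m by (simp add: xy word_action_def map_permute_positions[OF H mem(2) len[OF p]]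
          del: map_map)
    finally show ?thesis .
  qed
  have one: "?A \<one>\<^bsub>G \<times>\<times> H\<^esub> u = u" if u: "u \<in> ?W" for u
  proof -
    have "\<phi> \<one>\<^bsub>G\<^esub> a = a" if "a \<in> S" for a using G.id_eq_one[symmetric] that by simp
    then have "map (\<phi> \<one>\<^bsub>G\<^esub>) u = u" using u by (auto simp: words_def intro: map_idI)
    then show ?thesis using u by (simp add: word_action_def permute_positions_one[OF H len])
  qed
  have bij: "?A x \<in> Bij ?W" if x: "x \<in> carrier (G \<times>\<times> H)" for x
  proof -
    have "bij_betw (?A x) ?W ?W"
    proof (rule bij_betw_byWitness[where f' = "?A (inv\<^bsub>G \<times>\<times> H\<^esub> x)"])
      show "\<forall>u\<in>?W. ?A (inv\<^bsub>G \<times>\<times> H\<^esub> x) (?A x u) = u"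
        using mult[of "inv\<^bsub>G \<times>\<times> H\<^esub> x" x] x one P.l_inv[OF x] P.inv_closed[OF x] by metis
      show "\<forall>u\<in>?W. ?A x (?A (inv\<^bsub>G \<times>\<times> H\<^esub> x) u) = u"
        using mult[of x "inv\<^bsub>G \<times>\<times> H\<^esub> x"] x one P.r_inv[OF x] P.inv_closed[OF x] by metis
    qed (use closed x P.inv_closed[OF x] in blast)+
    moreover have "?A x \<in> extensional ?W" by (cases x) (simp add: word_action_def)
    ultimately show ?thesis by (simp add: Bij_def)
  qed
  have "?A (x \<otimes>\<^bsub>G \<times>\<times> H\<^esub> y) = compose ?W (?A x) (?A y)"
    if "x \<in> carrier (G \<times>\<times> H)" "y \<in> carrier (G \<times>\<times> H)" for x y
    using mult[OF that] bij[OF P.m_closed[OF that]]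
    by (intro extensionalityI[of _ ?W]) (auto simp: Bij_def compose_def)
  then have "?A \<in> hom (G \<times>\<times> H) (BijGroup ?W)"
    using bij by (auto simp: hom_def BijGroup_def)
  then show ?thesis
    unfolding group_action_def group_hom_def group_hom_axioms_def
    using P.is_group group_BijGroup by blast
qed

lemma equiv_factor_equiv:
  assumes "group_action G S \<phi>" "group_action H {..<l} \<psi>" "factors w l \<subseteq> words S l"
  shows "equiv (factors w l) (factor_equiv G \<phi> H \<psi> S w l)"
proof -
  interpret A: group_action "G \<times>\<times> H" "words S l" "word_action \<phi> H \<psi> S l"
    by (rule group_action_word_action) fact+
  have in_words: "u \<in> words S l" if "u \<in> factors w l" for u using assms(3) that by blast
  show ?thesis
  proof (rule equivI)
    show "factor_equiv G \<phi> H \<psi> S w l \<subseteq> factors w l \<times> factors w l"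
      by (auto simp: factor_equiv_def)
    show "refl_on (factors w l) (factor_equiv G \<phi> H \<psi> S w l)"
      using A.orbit_refl in_words by (auto simp: factor_equiv_def refl_on_def)
    show "sym (factor_equiv G \<phi> H \<psi> S w l)"
      using A.orbit_sym in_words by (auto simp: factor_equiv_def intro!: symI)
    show "trans (factor_equiv G \<phi> H \<psi> S w l)"
      unfolding factor_equiv_def by (rule transI) (use A.orbit_trans in_words in blast)
  qed
qed

lemma factors_sturmian_subset:
  assumes "0 < \<alpha>" "\<alpha> < 1"
  shows "factors (sturmian \<alpha>) l \<subseteq> words {0, 1} l"
proof -
  have "sturmian \<alpha> n \<in> {0, 1}" for n
  proof -
    have "(real n + 2) * \<alpha> = (real n + 1) * \<alpha> + \<alpha>" by (simp add: algebra_simps)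
    then show ?thesis using assms unfolding sturmian_def by (simp, linarith)
  qed
  then have "set (sturmian \<alpha> [i \<rightarrow> i + l]) \<subseteq> {0, 1}" for i
    unfolding subsequence_def by fastforce
  then show ?thesis unfolding factors_def words_def by fastforce
qed

end

theory Submission
  imports Defs "HOL-Combinatorics.List_Permutation"
begin

text \<open>
  Permuting positions can reach exactly the rearrangements of a word, and exchanging the letters of
  a binary word exchanges the number of ones with the number of zeros. Hence the orbit of a binary
  word is determined by its length and by the number of occurrences of its rarer letter
  (\<open>orbit_binary_iff\<close>), and the complexity is the number of values that this minority count
  takes on the factors of length \<open>l\<close>.

  In a Sturmian word the number of ones in a factor telescopes to a difference of two floors,
  so it is \<open>k\<close> or \<open>k + 1\<close>, where \<open>k = \<lfloor>l * \<alpha>\<rfloor>\<close>. Both values occur: if every factor of length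
  \<open>l\<close> had the same number \<open>c\<close> of ones, cutting long prefixes into blocks of length \<open>l\<close>
  would give \<open>c\<close> as the mean number \<open>l * \<alpha>\<close> of ones per block, but \<open>l * \<alpha>\<close> is
  irrational (\<open>ones_not_constant\<close>).

  When \<open>\<alpha> < 1 / 4\<close> and \<open>l > 1\<close>, even \<open>k + 1\<close> is at most half of \<open>l\<close>, so one is the minority letter
  and the counts \<open>k\<close> and \<open>k + 1\<close> give two distinct classes. When \<open>l = 1\<close>, the factors \<open>0\<close> and
  \<open>1\<close> both have minority count zero.
\<close>

section \<open>Orbits of words under permutations of letters and positions\<close>

lemma carrier_BijGroup: "carrier (BijGroup S) = Bij S"
  by (simp add: BijGroup_def)

lemma mset_permute_positions:
  assumes h: "h \<in> Bij {..<length u}"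
  shows "mset (permute_positions (BijGroup {..<length u}) (\<lambda>h. h) h u) = mset u"
proof -
  let ?H = "BijGroup {..<length u}"
  interpret H: group ?H by (rule group_BijGroup)
  have "inv\<^bsub>?H\<^esub> h \<in> Bij {..<length u}"
    using H.inv_closed[of h] h unfolding carrier_BijGroup by blast
  then have b: "bij_betw (inv\<^bsub>?H\<^esub> h) {..<length u} {..<length u}"
    by (simp add: Bij_def)
  have "mset (permute_positions ?H (\<lambda>h. h) h u)
      = image_mset ((!) u) (image_mset (inv\<^bsub>?H\<^esub> h) (mset_set {..<length u}))"
    by (simp add: permute_positions_def multiset.map_comp comp_def atLeast0LessThan)
  also have "\<dots> = image_mset ((!) u) (mset_set {..<length u})"
    using b by (simp add: image_mset_mset_set bij_betw_def)
  also have "\<dots> = mset u"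
    by (metis atLeast0LessThan map_nth mset_map mset_upt)
  finally show ?thesis .
qed

lemma permute_positions_exists:
  assumes "mset v = mset u"
  shows "\<exists>h\<in>Bij {..<length u}. permute_positions (BijGroup {..<length u}) (\<lambda>h. h) h u = v"
proof -
  let ?H = "BijGroup {..<length u}"
  interpret H: group ?H by (rule group_BijGroup)
  obtain p where p: "p permutes {..<length u}" and v: "permute_list p u = v"
    using mset_eq_permutation[OF assms] .
  let ?q = "restrict p {..<length u}"
  have q: "?q \<in> carrier ?H"
    using permutes_imp_bij[OF p] by (simp add: carrier_BijGroup Bij_def)
  \<comment> \<open>Positions are moved by the inverse of the acting element, so \<open>p\<close> itself must be inverted.\<close>
  have "permute_positions ?H (\<lambda>h. h) (inv\<^bsub>?H\<^esub> ?q) u = v"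
    using q by (simp add: permute_positions_def permute_list_def flip: v)
  moreover have "inv\<^bsub>?H\<^esub> ?q \<in> Bij {..<length u}"
    using H.inv_closed[OF q] unfolding carrier_BijGroup .
  ultimately show ?thesis by blast
qed

lemma orbit_word_action_Bij:
  assumes "u \<in> words S l"
  shows "orbit (BijGroup S \<times>\<times> BijGroup {..<l})
           (word_action (\<lambda>g. g) (BijGroup {..<l}) (\<lambda>h. h) S l) u
         = {map g v | g v. g \<in> Bij S \<and> mset v = mset u}"
proof -
  let ?perm = "permute_positions (BijGroup {..<l}) (\<lambda>h. h)"
  have len: "length u = l" using assms by (simp add: words_def)
  have reach: "mset v = mset u \<longleftrightarrow> (\<exists>h. h \<in> Bij {..<l} \<and> v = ?perm h u)" for v
  proof
    assume "mset v = mset u"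
    then show "\<exists>h. h \<in> Bij {..<l} \<and> v = ?perm h u"
      using permute_positions_exists[of v u] len by auto
  qed (use mset_permute_positions[of _ u] len in auto)
  have "{map g (?perm h u) | g h. g \<in> Bij S \<and> h \<in> Bij {..<l}}
      = {map g v | g v. g \<in> Bij S \<and> mset v = mset u}"
    unfolding reach by auto
  then show ?thesis
    using assms by (simp add: orbit_def word_action_def DirProd_def carrier_BijGroup)
qed

section \<open>Binary words\<close>

lemma sum_list_binary:
  fixes u :: "int list"
  assumes "set u \<subseteq> {0, 1}"
  shows "sum_list u = int (count (mset u) 1)"
    and "int (length u) - sum_list u = int (count (mset u) 0)"
  using assms by (induction u) auto

lemma mset_binary_eq_iff:
  fixes u v :: "int list"
  assumes u: "u \<in> words {0, 1} l" and v: "v \<in> words {0, 1} l"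
  shows "mset u = mset v \<longleftrightarrow> sum_list u = sum_list v"
proof
  assume s: "sum_list u = sum_list v"
  have uv: "set u \<subseteq> {0, 1}" "set v \<subseteq> {0, 1}" "length u = length v"
    using u v by (auto simp: words_def)
  show "mset u = mset v"
  proof (rule multiset_eqI)
    fix x :: int
    show "count (mset u) x = count (mset v) x"
    proof (cases "x \<in> {0, 1}")
      case True
      then show ?thesis
        using s uv(3) sum_list_binary[OF uv(1)] sum_list_binary[OF uv(2)] by auto
    next
      case False
      then have "x \<notin> set u" "x \<notin> set v" using uv by auto
      then show ?thesis by (metis count_mset_0_iff)
    qed
  qed
qed (metis sum_mset_sum_list)

lemma sum_list_complement: "sum_list (map (\<lambda>x. 1 - x) u) = int (length u) - sum_list u"
  by (induction u) auto

lemma complement_in_words: "u \<in> words {0, 1 :: int} l \<Longrightarrow> map (\<lambda>x. 1 - x) u \<in> words {0, 1} l"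
  by (auto simp: words_def)

lemma map_Bij_binary:
  fixes u :: "int list"
  assumes g: "g \<in> Bij {0, 1}" and u: "set u \<subseteq> {0, 1}"
  shows "map g u = u \<or> map g u = map (\<lambda>x. 1 - x) u"
proof -
  have "g 0 \<in> {0, 1}" "g 1 \<in> {0, 1}" "g 0 \<noteq> g 1"
    using g by (auto simp: Bij_def bij_betw_def)
  then consider "g 0 = 0" "g 1 = 1" | "g 0 = 1" "g 1 = 0" by auto
  then show ?thesis
  proof cases
    case 1
    then have "map g u = u" using u by (intro map_idI) auto
    then show ?thesis ..
  next
    case 2
    then have "map g u = map (\<lambda>x. 1 - x) u" using u by (intro map_cong) auto
    then show ?thesis ..
  qed
qed

lemma orbit_binary:
  fixes u :: "int list"
  assumes u: "u \<in> words {0, 1} l"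
  shows "orbit (BijGroup {0, 1} \<times>\<times> BijGroup {..<l})
           (word_action (\<lambda>g. g) (BijGroup {..<l}) (\<lambda>h. h) {0, 1} l) u
         = {v. mset v = mset u} \<union> map (\<lambda>x. 1 - x) ` {v. mset v = mset u}" (is "_ = ?R")
proof -
  have v01: "set v \<subseteq> {0, 1}" if "mset v = mset u" for v
    using that u mset_eq_setD[OF that] by (simp add: words_def)
  have "{map g v | g v. g \<in> Bij {0, 1} \<and> mset v = mset u} = ?R"
  proof (intro equalityI subsetI)
    fix x assume "x \<in> {map g v | g v. g \<in> Bij {0, 1} \<and> mset v = mset u}"
    then obtain g v where "g \<in> Bij {0, 1}" and v: "mset v = mset u" and "x = map g v" by blast
    then have "x = v \<or> x = map (\<lambda>x. 1 - x) v" using map_Bij_binary v01 by blast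
    then show "x \<in> ?R" using v by blast
  next
    fix x assume "x \<in> ?R"
    then obtain v where v: "mset v = mset u" "x = v \<or> x = map (\<lambda>x. 1 - x) v" by blast
    let ?i = "\<lambda>x\<in>{0, 1 :: int}. x" and ?c = "\<lambda>x\<in>{0, 1 :: int}. 1 - x"
    have "?i \<in> Bij {0, 1}" "?c \<in> Bij {0, 1}"
      by (auto simp: Bij_def bij_betw_def inj_on_def)
    moreover have "map ?i v = v" "map ?c v = map (\<lambda>x. 1 - x) v"
      using v01[OF v(1)] by (auto intro!: map_idI)
    ultimately show "x \<in> {map g v | g v. g \<in> Bij {0, 1} \<and> mset v = mset u}"
      using v by (smt (verit) mem_Collect_eq)
  qed
  then show ?thesis using orbit_word_action_Bij[OF u] by simp
qed

definition minority_count :: "int list \<Rightarrow> int" where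
  "minority_count u = min (sum_list u) (int (length u) - sum_list u)"

text \<open>
  Passing to the rarer letter is what makes the count of ones insensitive to exchanging the two
  letters; conversely, all words of one length with a given minority count are rearrangements of one
  of them or of its complement.
\<close>

lemma orbit_binary_iff:
  fixes u v :: "int list"
  assumes u: "u \<in> words {0, 1} l" and v: "v \<in> words {0, 1} l"
  shows "v \<in> orbit (BijGroup {0, 1} \<times>\<times> BijGroup {..<l})
               (word_action (\<lambda>g. g) (BijGroup {..<l}) (\<lambda>h. h) {0, 1} l) u
         \<longleftrightarrow> minority_count u = minority_count v"
proof -
  let ?c = "map (\<lambda>x::int. 1 - x)"
  have len: "length u = l" "length v = l" using u v by (auto simp: words_def)
  have cc: "?c (?c w) = w" for w by (simp add: comp_def)
  have "v \<in> ?c ` {w. mset w = mset u} \<longleftrightarrow> mset (?c v) = mset u"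
    using cc by (metis (mono_tags, lifting) imageE image_eqI mem_Collect_eq)
  then have "v \<in> {w. mset w = mset u} \<union> ?c ` {w. mset w = mset u}
      \<longleftrightarrow> sum_list v = sum_list u \<or> sum_list (?c v) = sum_list u"
    using mset_binary_eq_iff[OF v u] mset_binary_eq_iff[OF complement_in_words[OF v] u] by blast
  also have "\<dots> \<longleftrightarrow> minority_count u = minority_count v"
    by (auto simp: minority_count_def sum_list_complement len)
  finally show ?thesis by (simp add: orbit_binary[OF u])
qed

section \<open>Counting classes\<close>

lemma card_quotient_kernel:
  "card (A // {(u, v). u \<in> A \<and> v \<in> A \<and> f u = f v}) = card (f ` A)"
proof -
  let ?F = "\<lambda>y. {v \<in> A. f v = y}"
  have "A // {(u, v). u \<in> A \<and> v \<in> A \<and> f u = f v} = ?F ` f ` A"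
  proof -
    have "{(u, v). u \<in> A \<and> v \<in> A \<and> f u = f v} `` {x} = ?F (f x)" if "x \<in> A" for x
      using that by auto
    then show ?thesis by (simp add: quotient_def image_image UNION_singleton_eq_range)
  qed
  moreover have "inj_on ?F (f ` A)"
    by (rule inj_onI) blast
  ultimately show ?thesis by (simp add: card_image)
qed

lemma group_complexity_binary:
  assumes "factors w l \<subseteq> words {0, 1} l"
  shows "group_complexity (BijGroup {0, 1}) (\<lambda>g. g) (BijGroup {..<l}) (\<lambda>h. h) {0, 1} w l
         = card (minority_count ` factors w l)"
proof -
  have "factor_equiv (BijGroup {0, 1}) (\<lambda>g. g) (BijGroup {..<l}) (\<lambda>h. h) {0, 1} w l
      = {(u, v). u \<in> factors w l \<and> v \<in> factors w l \<and> minority_count u = minority_count v}"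
    unfolding factor_equiv_def using orbit_binary_iff[OF subsetD[OF assms] subsetD[OF assms]]
    by blast
  then show ?thesis
    by (simp add: group_complexity_def card_quotient_kernel)
qed

section \<open>Ones in the factors of a Sturmian word\<close>

definition ones :: "real \<Rightarrow> nat \<Rightarrow> nat \<Rightarrow> int" where
  "ones \<alpha> i l = \<lfloor>(real (i + l) + 1) * \<alpha>\<rfloor> - \<lfloor>(real i + 1) * \<alpha>\<rfloor>"

lemma sum_list_sturmian: "sum_list (sturmian \<alpha> [i \<rightarrow> i + l]) = ones \<alpha> i l"
  by (induction l) (auto simp: ones_def sturmian_def subsequence_def algebra_simps)

lemma ones_cases: "ones \<alpha> i l = \<lfloor>real l * \<alpha>\<rfloor> \<or> ones \<alpha> i l = \<lfloor>real l * \<alpha>\<rfloor> + 1"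
proof -
  have "(real (i + l) + 1) * \<alpha> = (real i + 1) * \<alpha> + real l * \<alpha>"
    by (simp add: algebra_simps)
  then show ?thesis unfolding ones_def by linarith
qed

text \<open>
  The first \<open>m\<close> consecutive blocks together contain \<open>\<lfloor>(m * l + 1) * \<alpha>\<rfloor> - \<lfloor>\<alpha>\<rfloor>\<close> ones, which
  differs from \<open>m * (l * \<alpha>)\<close> by less than one. So \<open>m * c\<close> stays within distance one of
  \<open>m * (l * \<alpha>)\<close> for all \<open>m\<close>, which forces \<open>c = l * \<alpha>\<close>.
\<close>

lemma ones_not_constant:
  assumes irr: "\<alpha> \<notin> \<rat>" and l: "l > 0"
  shows "\<exists>i. ones \<alpha> i l \<noteq> c"
proof (rule ccontr)
  assume "\<nexists>i. ones \<alpha> i l \<noteq> c"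
  then have const: "ones \<alpha> i l = c" for i by blast
  have blocks: "ones \<alpha> 0 (m * l) = int m * c" for m
  proof (induction m)
    case (Suc m)
    have "ones \<alpha> 0 (Suc m * l) = ones \<alpha> 0 (m * l) + ones \<alpha> (m * l) l"
      by (simp add: ones_def add.commute)
    then show ?case using Suc const by (simp add: algebra_simps)
  qed (simp add: ones_def)
  have near: "real m * \<bar>real l * \<alpha> - real_of_int c\<bar> < 1" for m
  proof -
    have "(real (m * l) + 1) * \<alpha> = real m * (real l * \<alpha>) + \<alpha>"
      by (simp add: algebra_simps)
    then have "int m * c = \<lfloor>real m * (real l * \<alpha>) + \<alpha>\<rfloor> - \<lfloor>\<alpha>\<rfloor>"
      using blocks[of m] by (simp add: ones_def)
    moreover have "\<bar>x - real_of_int (\<lfloor>x + \<alpha>\<rfloor> - \<lfloor>\<alpha>\<rfloor>)\<bar> < 1" for x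
      by linarith
    ultimately have "\<bar>real m * (real l * \<alpha>) - real_of_int (int m * c)\<bar> < 1"
      by simp
    moreover have "real m * (real l * \<alpha>) - real_of_int (int m * c)
        = real m * (real l * \<alpha> - real_of_int c)" by (simp add: algebra_simps)
    ultimately show ?thesis by (simp add: abs_mult)
  qed
  have "real l * \<alpha> \<noteq> real_of_int c"
  proof
    assume "real l * \<alpha> = real_of_int c"
    then have "\<alpha> = real_of_int c / real l" using l by (simp add: field_simps)
    then show False using irr by (simp add: Rats_divide)
  qed
  then obtain m where "1 < real m * \<bar>real l * \<alpha> - real_of_int c\<bar>"
    using reals_Archimedean3[of "\<bar>real l * \<alpha> - real_of_int c\<bar>"] by auto
  with near[of m] show False by simp
qed

lemma range_ones:
  assumes "\<alpha> \<notin> \<rat>" "l > 0"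
  shows "range (\<lambda>i. ones \<alpha> i l) = {\<lfloor>real l * \<alpha>\<rfloor>, \<lfloor>real l * \<alpha>\<rfloor> + 1}" (is "_ = {?k, _}")
proof -
  obtain i j where "ones \<alpha> i l \<noteq> ?k" "ones \<alpha> j l \<noteq> ?k + 1"
    using ones_not_constant[OF assms] by metis
  then have "ones \<alpha> i l = ?k + 1" "ones \<alpha> j l = ?k"
    using ones_cases by blast+
  then have "{?k, ?k + 1} \<subseteq> range (\<lambda>i. ones \<alpha> i l)"
    by (metis empty_subsetI insert_subset rangeI)
  then show ?thesis using ones_cases by blast
qed

theorem proposition3p5:
  fixes \<alpha> :: real and l :: nat
  assumes "\<alpha> \<notin> \<rat>" and "0 < \<alpha>" and "\<alpha> < 1 / 4" and "l > 0"
  shows "group_complexity (BijGroup {0, 1}) (\<lambda>g. g) (BijGroup {..<l}) (\<lambda>h. h) {0, 1} (sturmian \<alpha>) l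
         = (if l = 1 then 1 else 2)"
proof -
  define k where "k = \<lfloor>real l * \<alpha>\<rfloor>"
  have "factors (sturmian \<alpha>) l \<subseteq> words {0, 1} l"
    by (rule factors_sturmian_subset) (use assms in auto)
  then have "group_complexity (BijGroup {0, 1}) (\<lambda>g. g) (BijGroup {..<l}) (\<lambda>h. h) {0, 1}
      (sturmian \<alpha>) l = card (minority_count ` factors (sturmian \<alpha>) l)"
    by (rule group_complexity_binary)
  also have "minority_count ` factors (sturmian \<alpha>) l
      = (\<lambda>s. min s (int l - s)) ` range (\<lambda>i. ones \<alpha> i l)"
    by (auto simp: factors_def minority_count_def sum_list_sturmian image_def)
  also have "\<dots> = {min k (int l - k), min (k + 1) (int l - (k + 1))}"
    using range_ones[OF assms(1,4)] by (simp add: k_def)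
  also have "card \<dots> = (if l = 1 then 1 else 2)"
  proof (cases "l = 1")
    case True
    then have "k = 0" using assms by (simp add: k_def floor_eq_iff)
    then show ?thesis using True by simp
  next
    case False
    have less: "4 * k < int l"
    proof -
      have "4 * (real l * \<alpha>) < real l" using assms by simp
      then show ?thesis unfolding k_def by linarith
    qed
    \<comment> \<open>If \<open>k \<ge> 1\<close>, then \<open>2 * k + 2 \<le> 4 * k < l\<close>; if \<open>k \<le> 0\<close>, then \<open>2 \<le> l\<close> suffices.\<close>
    have "2 * k + 2 \<le> int l" using less False assms(4) by presburger
    then have "min k (int l - k) = k" "min (k + 1) (int l - (k + 1)) = k + 1" by linarith+
    then show ?thesis using False by simp
  qed
  finally show ?thesis .
qed

end
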